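(* Suppose that $\varphi$ is an analytic self-map of the unit disk $D$ and $0<p<\infty$. Then the composition operator $C_\varphi : A^p\to\mathcal{B}$ is bounded if and only if $$\sup_{z\in D}\frac{(1-|z|^2)|\varphi'(z)|}{(1-|\varphi(z)|^2)^{1+2/p}}<\infty.$$
   Context: $D$ is the open unit disk in $\mathbb{C}$ and $H(D)$ is the class of all analytic functions on $D$. An analytic self-map of $D$ is an analytic function $\varphi:D\to D$; it induces the composition operator $C_\varphi f=f\circ\varphi$, $f\in H(D)$. For $0<p<\infty$, the Bergman space $A^p$ is the space of $f\in H(D)$ with $\int_D|f(z)|^p\,dA(z)<\infty$, where $dA$ is the normalized Lebesgue area measure on $D$ ($A(D)=1$), with the usual norm (quasinorm if $p<1$) $\left(\int_D|f|^p\,dA\right)^{1/p}$. The Bloch space $\mathcal{B}$ is the space of $f\in H(D)$ with $B(f)=\sup_{z\in D}(1-|z|^2)|f'(z)|<\infty$, normed by $\|f\|_{\mathcal{B}}=|f(0)|+B(f)$. A linear operator is bounded if it maps the first space into the second and the image of every bounded set is bounded. *)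

theory Defs
  imports "HOL-Complex_Analysis.Complex_Analysis"
begin

text \<open>
  Elements of the function spaces are total functions on the complex plane; everything below
  depends only on their values on the unit disk, so values outside the disk are irrelevant.
\<close>

abbreviation unit_disk :: "complex set" where
  "unit_disk \<equiv> ball 0 1"

definition analytic_self_map :: "(complex \<Rightarrow> complex) \<Rightarrow> bool" where
  "analytic_self_map \<phi> \<longleftrightarrow> \<phi> holomorphic_on unit_disk \<and> \<phi> ` unit_disk \<subseteq> unit_disk"

definition composition_operator ::
    "(complex \<Rightarrow> complex) \<Rightarrow> (complex \<Rightarrow> complex) \<Rightarrow> complex \<Rightarrow> complex" where
  "composition_operator \<phi> f = f \<circ> \<phi>"

definition disk_area :: "complex measure" where
  "disk_area = scale_measure (ennreal (1 / pi)) (restrict_space lborel unit_disk)"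

lemma emeasure_disk_area_unit_disk: "emeasure disk_area unit_disk = 1"
proof -
  have "emeasure (restrict_space lborel unit_disk) unit_disk = emeasure lborel unit_disk"
    by (subst emeasure_restrict_space) auto
  also have "\<dots> = ennreal pi"
    by (simp add: emeasure_ball unit_ball_vol_2)
  finally show ?thesis
    by (simp add: disk_area_def ennreal_mult'' [symmetric])
qed

definition bergman_space :: "real \<Rightarrow> (complex \<Rightarrow> complex) set" where
  "bergman_space p =
    {f. f holomorphic_on unit_disk \<and> integrable disk_area (\<lambda>z. norm (f z) powr p)}"

definition bergman_norm :: "real \<Rightarrow> (complex \<Rightarrow> complex) \<Rightarrow> real" where
  "bergman_norm p f = (\<integral>z. norm (f z) powr p \<partial>disk_area) powr (1 / p)"

definition bloch_space :: "(complex \<Rightarrow> complex) set" where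
  "bloch_space =
    {f. f holomorphic_on unit_disk \<and>
        bdd_above ((\<lambda>z. (1 - (norm z)\<^sup>2) * norm (deriv f z)) ` unit_disk)}"

text \<open>The real-valued supremum is meaningful only for members of \<^const>\<open>bloch_space\<close>.\<close>

definition bloch_seminorm :: "(complex \<Rightarrow> complex) \<Rightarrow> real" where
  "bloch_seminorm f = (SUP z\<in>unit_disk. (1 - (norm z)\<^sup>2) * norm (deriv f z))"

definition bloch_norm :: "(complex \<Rightarrow> complex) \<Rightarrow> real" where
  "bloch_norm f = norm (f 0) + bloch_seminorm f"

text \<open>
  Boundedness of an operator between spaces \<open>X\<close>, \<open>Y\<close> with (quasi)norms \<open>nX\<close>, \<open>nY\<close>:
  it maps \<open>X\<close> into \<open>Y\<close>, and bounded sets to bounded sets.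
\<close>

definition norm_bounded :: "('a \<Rightarrow> real) \<Rightarrow> 'a set \<Rightarrow> bool" where
  "norm_bounded n S \<longleftrightarrow> (\<exists>M. \<forall>f\<in>S. n f \<le> M)"

definition bounded_operator ::
    "'a set \<Rightarrow> ('a \<Rightarrow> real) \<Rightarrow> 'b set \<Rightarrow> ('b \<Rightarrow> real) \<Rightarrow> ('a \<Rightarrow> 'b) \<Rightarrow> bool" where
  "bounded_operator X nX Y nY T \<longleftrightarrow>
    T ` X \<subseteq> Y \<and> (\<forall>S\<subseteq>X. norm_bounded nX S \<longrightarrow> norm_bounded nY (T ` S))"

end

theory Submission
  imports Defs
begin

text \<open>
  The weight \<open>(1 - \<bar>w\<bar>\<^sup>2) powr (1 + 2 / p)\<close> is, up to constants, the reciprocal of the norm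
  of the functional \<open>f \<mapsto> f' w\<close> on \<open>A\<^sup>p\<close>. By the chain rule
  \<open>(f \<circ> \<phi>)' z = f' (\<phi> z) * \<phi>' z\<close>, the quantity in the criterion is therefore comparable to the norm
  of \<open>f \<mapsto> (1 - \<bar>z\<bar>\<^sup>2) * (f \<circ> \<phi>)' z\<close>, and its supremum over \<open>z\<close> governs the Bloch seminorm
  of \<open>f \<circ> \<phi>\<close>.

  The upper estimate of \<open>f' w\<close> (\<open>bergman_deriv_growth\<close>) follows by Cauchy's inequality from the
  growth estimate \<open>\<bar>f w\<bar> \<le> C * \<parallel>f\<parallel> / (1 - \<bar>w\<bar>) powr (2 / p)\<close> (\<open>bergman_growth\<close>). The usual route
  to the latter is subharmonicity of \<open>\<bar>f\<bar> powr p\<close>. Here it comes from a maximum argument that treats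
  all \<open>p > 0\<close> alike (\<open>holomorphic_large_on_small_ball\<close>): \<open>\<bar>f\<bar>\<close>, weighted by a power of the distance
  to the boundary of a ball about \<open>w\<close>, attains its maximum at some \<open>z\<^sub>0\<close>; near \<open>z\<^sub>0\<close> the function is
  bounded by a multiple of \<open>\<bar>f z\<^sub>0\<bar>\<close>, hence varies slowly, hence stays above \<open>\<bar>f z\<^sub>0\<bar> / 2\<close> on a
  ball of controlled radius, and that ball alone contributes enough to the norm of \<open>f\<close>.

  The lower estimate uses the test functions
  \<open>(1 - \<bar>w\<bar>\<^sup>2) powr (2 / p) * (1 - cnj w * z) powr (- 4 / p)\<close> of \<open>z\<close>, with \<open>w\<close>
  a value of \<open>\<phi>\<close> (\<open>bergman_test\<close>). Their \<open>A\<^sup>p\<close> norms are bounded uniformly over \<open>\<bar>w\<bar> \<ge> 1 / 2\<close>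
  (\<open>bergman_norm_bergman_test_le\<close>), since \<open>\<bar>1 - cnj w * z\<bar>\<close> is then comparable to the distance from
  \<open>z\<close> to \<open>1 / cnj w\<close>, a point outside the disk whose distance to it is at least \<open>1 - \<bar>w\<bar>\<close>. The
  derivative of the test function at \<open>w\<close> carries a factor \<open>\<bar>w\<bar>\<close>, so it is of use only for \<open>\<bar>w\<bar>\<close>
  bounded away from \<open>0\<close>; where \<open>\<bar>\<phi> z\<bar> < 1 / 2\<close> the denominator in the criterion is bounded
  below, and the image of the identity function settles the matter.
\<close>

section \<open>Area measure on the disk and Bergman spaces\<close>

lemma space_disk_area [simp]: "space disk_area = unit_disk"
  by (simp add: disk_area_def space_scale_measure space_restrict_space)

lemma sets_disk_area: "sets disk_area = sets (restrict_space borel unit_disk)"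
  by (simp add: disk_area_def sets_restrict_space)

lemma finite_measure_disk_area: "finite_measure disk_area"
  by (rule finite_measureI) (simp add: emeasure_disk_area_unit_disk)

lemma continuous_imp_measurable_disk_area:
  fixes f :: "complex \<Rightarrow> 'a::topological_space"
  assumes "continuous_on unit_disk f"
  shows "f \<in> borel_measurable disk_area"
  using borel_measurable_continuous_on_restrict[OF assms]
  by (simp cong: measurable_cong_sets add: sets_disk_area)

lemma nn_integral_disk_area:
  assumes "f \<in> borel_measurable disk_area"
  shows "(\<integral>\<^sup>+z. f z \<partial>disk_area) = ennreal (1 / pi) * (\<integral>\<^sup>+z\<in>unit_disk. f z \<partial>lborel)"
proof -
  have "f \<in> borel_measurable (restrict_space lborel unit_disk)"
    using assms by (simp cong: measurable_cong_sets add: disk_area_def)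
  then show ?thesis
    by (simp add: disk_area_def nn_integral_scale_measure nn_integral_restrict_space)
qed

lemma emeasure_lborel_complex_ball:
  "0 \<le> r \<Longrightarrow> emeasure lborel (ball (c::complex) r) = ennreal (pi * r\<^sup>2)"
  by (simp add: emeasure_ball unit_ball_vol_2)

lemma measure_disk_area_ball:
  assumes "0 \<le> r" "ball c r \<subseteq> unit_disk"
  shows "ball c r \<in> sets disk_area" "measure disk_area (ball c r) = r\<^sup>2"
proof -
  show "ball c r \<in> sets disk_area"
    using assms by (simp add: sets_disk_area sets_restrict_space_iff)
  have "emeasure (restrict_space lborel unit_disk) (ball c r) = ennreal (pi * r\<^sup>2)"
    using assms by (subst emeasure_restrict_space) (auto simp: emeasure_lborel_complex_ball)
  then have "emeasure disk_area (ball c r) = ennreal (r\<^sup>2)"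
    by (simp add: disk_area_def ennreal_mult'' [symmetric])
  then show "measure disk_area (ball c r) = r\<^sup>2"
    by (simp add: measure_def)
qed

lemma norm_powr_measurable_disk_area:
  fixes f :: "complex \<Rightarrow> complex"
  assumes "continuous_on unit_disk f"
  shows "(\<lambda>z. norm (f z) powr p) \<in> borel_measurable disk_area"
  using continuous_imp_measurable_disk_area[OF assms] by measurable

lemma bounded_holomorphic_in_bergman_space:
  assumes p: "0 < p" and hol: "f holomorphic_on unit_disk"
    and bound: "\<And>z. z \<in> unit_disk \<Longrightarrow> norm (f z) \<le> M"
  shows "f \<in> bergman_space p"
proof -
  interpret finite_measure disk_area by (rule finite_measure_disk_area)
  have "integrable disk_area (\<lambda>z. norm (f z) powr p)"
  proof (rule integrable_const_bound)
    show "AE z in disk_area. norm (norm (f z) powr p) \<le> M powr p"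
      using p bound by (intro AE_I2) (auto intro: powr_mono2)
    show "(\<lambda>z. norm (f z) powr p) \<in> borel_measurable disk_area"
      by (intro norm_powr_measurable_disk_area holomorphic_on_imp_continuous_on hol)
  qed
  then show ?thesis by (simp add: bergman_space_def hol)
qed

lemma bergman_norm_nonneg: "0 \<le> bergman_norm p f"
  by (simp add: bergman_norm_def)

section \<open>Growth of Bergman functions\<close>

text \<open>
  The point \<open>z\<^sub>0\<close> maximises \<open>\<bar>f z\<bar> * (r - dist w z) powr q\<close>. If \<open>t\<close> is the distance from \<open>z\<^sub>0\<close> to the
  boundary sphere, then moving from \<open>z\<^sub>0\<close> by at most \<open>t / 2\<close> at most halves the distance to that
  sphere, so maximality gives \<open>\<bar>f\<bar> \<le> 2 powr q * \<bar>f z\<^sub>0\<bar>\<close> there. Cauchy's inequality turns this into a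
  bound for \<open>f'\<close>, and on a ball whose radius \<open>\<rho>\<close> is a fixed multiple of \<open>t\<close> the function cannot drop
  below half of its value at the centre. The last conclusion is maximality compared with the
  centre \<open>w\<close>, with \<open>t\<close> expressed through \<open>\<rho>\<close>.
\<close>
lemma holomorphic_large_on_small_ball:
  fixes f :: "complex \<Rightarrow> complex" and q r :: real
  assumes q: "0 < q" and r: "0 < r"
    and hol: "f holomorphic_on ball w r" and cont: "continuous_on (cball w r) f"
  obtains z\<^sub>0 \<rho> where "0 < \<rho>" "ball z\<^sub>0 \<rho> \<subseteq> ball w r"
    "\<And>z. z \<in> ball z\<^sub>0 \<rho> \<Longrightarrow> norm (f z\<^sub>0) / 2 \<le> norm (f z)"
    "norm (f w) * r powr q \<le> norm (f z\<^sub>0) * (8 * 2 powr q * \<rho>) powr q"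
proof (cases "f w = 0")
  case True
  \<comment> \<open>The weighted maximum may be \<open>0\<close> and attained on the sphere, so the centre itself is used.\<close>
  then show ?thesis using r by (intro that[of r w]) auto
next
  case False
  define g where "g z = norm (f z) * (r - dist w z) powr q" for z
  have "continuous_on (cball w r) g"
    unfolding g_def using q
    by (intro continuous_intros continuous_on_powr' cont) auto
  then obtain z\<^sub>0 where z0: "z\<^sub>0 \<in> cball w r" and max: "\<And>z. z \<in> cball w r \<Longrightarrow> g z \<le> g z\<^sub>0"
    using continuous_attains_sup[of "cball w r" g] r by auto
  define t where "t = r - dist w z\<^sub>0"
  have "0 < g w" using False r by (simp add: g_def)
  also have gw: "g w \<le> g z\<^sub>0" using r by (intro max) auto
  finally have pos: "0 < g z\<^sub>0" .
  have t: "0 < t" using pos z0 by (cases "t = 0") (auto simp: g_def t_def)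
  define M where "M = 2 powr q * norm (f z\<^sub>0)"
  have sub: "cball z\<^sub>0 (t/2) \<subseteq> ball w r"
  proof
    fix z assume "z \<in> cball z\<^sub>0 (t/2)"
    then show "z \<in> ball w r"
      using dist_triangle[of w z z\<^sub>0] t by (simp add: t_def)
  qed
  have bound: "norm (f z) \<le> M" if z: "z \<in> cball z\<^sub>0 (t/2)" for z
  proof -
    have "t/2 \<le> r - dist w z"
      using dist_triangle[of w z z\<^sub>0] z by (simp add: t_def)
    then have "norm (f z) * (t/2) powr q \<le> g z"
      unfolding g_def using q t by (intro mult_left_mono powr_mono2) auto
    also have "\<dots> \<le> g z\<^sub>0" using sub z by (intro max) auto
    also have "\<dots> = norm (f z\<^sub>0) * t powr q" by (simp add: g_def t_def)
    finally show ?thesis using t by (simp add: M_def powr_divide field_simps)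
  qed
  have deriv_bound: "norm (deriv f u) \<le> M / (t/4)" if u: "u \<in> ball z\<^sub>0 (t/4)" for u
  proof -
    have in_sub: "cball u (t/4) \<subseteq> cball z\<^sub>0 (t/2)"
    proof
      fix z assume "z \<in> cball u (t/4)"
      then show "z \<in> cball z\<^sub>0 (t/2)"
        using u dist_triangle[of z\<^sub>0 z u] by simp
    qed
    have hol': "f holomorphic_on cball u (t/4)"
      using hol in_sub sub by (meson holomorphic_on_subset order_trans)
    have "norm ((deriv ^^ 1) f u) \<le> fact 1 * M / (t/4) ^ 1"
    proof (rule Cauchy_inequality)
      show "f holomorphic_on ball u (t/4)"
        using hol' ball_subset_cball holomorphic_on_subset by blast
      show "continuous_on (cball u (t/4)) f"
        by (rule holomorphic_on_imp_continuous_on[OF hol'])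
      show "norm (f x) \<le> M" if "norm (u - x) = t/4" for x
        using in_sub that by (intro bound) (auto simp: dist_norm)
    qed (use t in auto)
    then show ?thesis by simp
  qed
  \<comment> \<open>This radius makes the oscillation bound \<open>M / (t / 4) * \<rho>\<close> equal to \<open>\<bar>f z\<^sub>0\<bar> / 2\<close>.\<close>
  define \<rho> where "\<rho> = t / (8 * 2 powr q)"
  have \<rho>: "0 < \<rho>" "\<rho> \<le> t/8"
    using t q by (auto simp: \<rho>_def field_simps ge_one_powr_ge_zero)
  show ?thesis
  proof (rule that)
    show "0 < \<rho>" by fact
    show "ball z\<^sub>0 \<rho> \<subseteq> ball w r"
      using sub \<rho> t by (auto simp: subset_iff)
    show "norm (f z\<^sub>0) / 2 \<le> norm (f z)" if z: "z \<in> ball z\<^sub>0 \<rho>" for z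
    proof -
      have "norm (f z\<^sub>0 - f z) \<le> M / (t/4) * norm (z\<^sub>0 - z)"
      proof (rule field_differentiable_bound[where S = "ball z\<^sub>0 (t/4)" and f' = "deriv f"])
        show "(f has_field_derivative deriv f u) (at u within ball z\<^sub>0 (t/4))"
          if "u \<in> ball z\<^sub>0 (t/4)" for u
        proof -
          have "u \<in> ball w r" using sub that t by (auto simp: subset_iff)
          then show ?thesis
            using holomorphic_derivI[OF hol open_ball] by (blast intro: has_field_derivative_at_within)
        qed
      qed (use deriv_bound z \<rho> t in auto)
      also have "\<dots> \<le> M / (t/4) * \<rho>"
        using z t by (intro mult_left_mono) (auto simp: dist_norm M_def)
      also have "\<dots> = norm (f z\<^sub>0) / 2" using t by (simp add: M_def \<rho>_def)
      finally have "norm (f z\<^sub>0 - f z) \<le> norm (f z\<^sub>0) / 2" .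
      then show ?thesis using norm_triangle_ineq2[of "f z\<^sub>0" "f z"] by simp
    qed
    have "8 * 2 powr q * \<rho> = t" by (simp add: \<rho>_def)
    then show "norm (f w) * r powr q \<le> norm (f z\<^sub>0) * (8 * 2 powr q * \<rho>) powr q"
      using gw by (simp add: g_def t_def)
  qed
qed

lemma bergman_norm_lower_bound:
  assumes p: "0 < p" and f: "f \<in> bergman_space p" and \<rho>: "0 \<le> \<rho>" "ball z\<^sub>0 \<rho> \<subseteq> unit_disk"
    and m: "0 \<le> m" "\<And>z. z \<in> ball z\<^sub>0 \<rho> \<Longrightarrow> m \<le> norm (f z)"
  shows "m * \<rho> powr (2 / p) \<le> bergman_norm p f"
proof -
  interpret finite_measure disk_area by (rule finite_measure_disk_area)
  note ball = measure_disk_area_ball[OF \<rho>]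
  have "m powr p * \<rho>\<^sup>2 = (\<integral>z. m powr p * indicator (ball z\<^sub>0 \<rho>) z \<partial>disk_area)"
    using ball \<rho>(2) by (simp add: Int_absorb2)
  also have "\<dots> \<le> (\<integral>z. norm (f z) powr p \<partial>disk_area)"
  proof (rule integral_mono)
    show "integrable disk_area (\<lambda>z. m powr p * indicat_real (ball z\<^sub>0 \<rho>) z)"
      using ball by (intro integrable_mult_right integrable_real_indicator)
        (auto simp: emeasure_eq_measure)
    show "integrable disk_area (\<lambda>z. norm (f z) powr p)"
      using f by (simp add: bergman_space_def)
    show "m powr p * indicat_real (ball z\<^sub>0 \<rho>) z \<le> norm (f z) powr p" for z
      using m p by (auto simp: indicator_def intro: powr_mono2)
  qed
  finally have "(m powr p * \<rho>\<^sup>2) powr (1 / p) \<le> bergman_norm p f"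
    unfolding bergman_norm_def using p by (intro powr_mono2) auto
  moreover have "(m powr p * \<rho>\<^sup>2) powr (1 / p) = m * \<rho> powr (2 / p)"
  proof (cases "\<rho> = 0")
    case False
    then have "\<rho>\<^sup>2 = \<rho> powr 2" using \<rho> by (simp add: powr_numeral)
    then show ?thesis using p m by (simp add: powr_mult powr_powr)
  qed simp
  ultimately show ?thesis by simp
qed

text \<open>
  With \<open>q = 2 / p\<close>, the factor \<open>\<rho> powr q\<close> coming from the weighted maximum is exactly the \<open>p\<close>-th root
  of the normalized area \<open>\<rho>\<^sup>2\<close> of the ball on which \<open>f\<close> is large.
\<close>
lemma bergman_growth:
  assumes p: "0 < p"
  obtains C where "0 < C" "\<And>f w. f \<in> bergman_space p \<Longrightarrow> w \<in> unit_disk \<Longrightarrow>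
    norm (f w) \<le> C * bergman_norm p f / (1 - norm w) powr (2 / p)"
proof
  define q where "q = 2 / p"
  define C where "C = 2 * (8 * 2 powr q) powr q * 2 powr q"
  show "0 < C" by (simp add: C_def)
  fix f w assume f: "f \<in> bergman_space p" and w: "w \<in> unit_disk"
  have q: "0 < q" using p by (simp add: q_def)
  define r where "r = (1 - norm w) / 2"
  have r: "0 < r" using w by (simp add: r_def)
  have sub: "cball w r \<subseteq> unit_disk"
  proof
    fix z assume "z \<in> cball w r"
    then show "z \<in> unit_disk"
      using norm_triangle_ineq2[of z w] w by (simp add: r_def dist_norm norm_minus_commute)
  qed
  have hol: "f holomorphic_on unit_disk" using f by (simp add: bergman_space_def)
  obtain z\<^sub>0 \<rho> where \<rho>: "0 < \<rho>" "ball z\<^sub>0 \<rho> \<subseteq> ball w r"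
    and large: "\<And>z. z \<in> ball z\<^sub>0 \<rho> \<Longrightarrow> norm (f z\<^sub>0) / 2 \<le> norm (f z)"
    and le: "norm (f w) * r powr q \<le> norm (f z\<^sub>0) * (8 * 2 powr q * \<rho>) powr q"
  proof (rule holomorphic_large_on_small_ball[OF q r])
    show "f holomorphic_on ball w r"
      using hol sub ball_subset_cball holomorphic_on_subset by (metis order_trans)
    show "continuous_on (cball w r) f"
      using hol sub holomorphic_on_imp_continuous_on continuous_on_subset by blast
  qed blast
  have "norm (f z\<^sub>0) / 2 * \<rho> powr q \<le> bergman_norm p f"
    unfolding q_def using \<rho> sub ball_subset_cball large
    by (intro bergman_norm_lower_bound p f) (auto simp: subset_iff)
  then have "2 * (8 * 2 powr q) powr q * (norm (f z\<^sub>0) / 2 * \<rho> powr q)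
      \<le> 2 * (8 * 2 powr q) powr q * bergman_norm p f"
    by (intro mult_left_mono) auto
  also have "2 * (8 * 2 powr q) powr q * (norm (f z\<^sub>0) / 2 * \<rho> powr q)
      = norm (f z\<^sub>0) * (8 * 2 powr q * \<rho>) powr q"
    using \<rho>(1) by (simp add: powr_mult)
  finally have "norm (f w) * r powr q \<le> 2 * (8 * 2 powr q) powr q * bergman_norm p f"
    using le by linarith
  moreover have "r powr q = (1 - norm w) powr q / 2 powr q"
    using w by (simp add: r_def powr_divide)
  ultimately show "norm (f w) \<le> C * bergman_norm p f / (1 - norm w) powr (2 / p)"
    using w by (simp add: C_def field_simps flip: q_def)
qed

lemma bergman_deriv_growth:
  assumes p: "0 < p"
  obtains C where "0 < C" "\<And>f w. f \<in> bergman_space p \<Longrightarrow> w \<in> unit_disk \<Longrightarrow>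
    norm (deriv f w) \<le> C * bergman_norm p f / (1 - (norm w)\<^sup>2) powr (1 + 2 / p)"
proof -
  obtain C where C: "0 < C" and growth: "\<And>f w. f \<in> bergman_space p \<Longrightarrow> w \<in> unit_disk \<Longrightarrow>
    norm (f w) \<le> C * bergman_norm p f / (1 - norm w) powr (2 / p)"
    using bergman_growth[OF p] by blast
  show thesis
  proof (rule that)
    show "0 < C * 4 powr (1 + 2 / p)" using C by simp
    fix f w assume f: "f \<in> bergman_space p" and w: "w \<in> unit_disk"
    define r where "r = (1 - norm w) / 2"
    have r: "0 < r" using w by (simp add: r_def)
    have edge: "r \<le> 1 - norm z" if "z \<in> cball w r" for z
      using norm_triangle_ineq2[of z w] that by (simp add: r_def dist_norm norm_minus_commute)
    have sub: "cball w r \<subseteq> unit_disk"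
      using edge r by fastforce
    have hol: "f holomorphic_on cball w r"
      using f sub by (auto simp: bergman_space_def intro: holomorphic_on_subset)
    have "norm ((deriv ^^ 1) f w) \<le> fact 1 * (C * bergman_norm p f / r powr (2 / p)) / r ^ 1"
    proof (rule Cauchy_inequality)
      show "f holomorphic_on ball w r"
        using hol ball_subset_cball holomorphic_on_subset by blast
      show "continuous_on (cball w r) f"
        by (rule holomorphic_on_imp_continuous_on[OF hol])
      fix z assume "norm (w - z) = r"
      then have z: "z \<in> cball w r" by (simp add: dist_norm)
      have "norm (f z) \<le> C * bergman_norm p f / (1 - norm z) powr (2 / p)"
        using z sub by (intro growth f) auto
      also have "\<dots> \<le> C * bergman_norm p f / r powr (2 / p)"
        using C r p edge[OF z] bergman_norm_nonneg
        by (intro divide_left_mono powr_mono2 mult_pos_pos mult_nonneg_nonneg) auto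
      finally show "norm (f z) \<le> C * bergman_norm p f / r powr (2 / p)" .
    qed (use r in auto)
    then have "norm (deriv f w) \<le> C * bergman_norm p f / r powr (1 + 2 / p)"
      using r by (simp add: powr_add mult_ac)
    also have "\<dots> \<le> C * bergman_norm p f / ((1 - (norm w)\<^sup>2) / 4) powr (1 + 2 / p)"
    proof -
      have "1 - (norm w)\<^sup>2 = (1 + norm w) * (1 - norm w)"
        by (simp add: power2_eq_square algebra_simps)
      also have "\<dots> \<le> 2 * (1 - norm w)" using w by (intro mult_right_mono) auto
      finally have "(1 - (norm w)\<^sup>2) / 4 \<le> r" by (simp add: r_def)
      moreover have "0 < 1 - (norm w)\<^sup>2" using w by (simp add: power_less_one_iff)
      ultimately show ?thesis
        using C r p bergman_norm_nonneg
        by (intro divide_left_mono powr_mono2 mult_pos_pos mult_nonneg_nonneg) auto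
    qed
    also have "\<dots> = C * 4 powr (1 + 2 / p) * bergman_norm p f / (1 - (norm w)\<^sup>2) powr (1 + 2 / p)"
      using w by (simp add: powr_divide power_le_one)
    finally show "norm (deriv f w)
        \<le> C * 4 powr (1 + 2 / p) * bergman_norm p f / (1 - (norm w)\<^sup>2) powr (1 + 2 / p)" .
  qed
qed

section \<open>Test functions of bounded Bergman norm\<close>

lemma dyadic_scale:
  fixes \<delta> x :: real
  assumes "0 < \<delta>" "\<delta> \<le> x"
  obtains k :: nat where "2 ^ k * \<delta> \<le> x" "x < 2 ^ Suc k * \<delta>"
proof -
  define n where "n = (LEAST n. x < 2 ^ n * \<delta>)"
  obtain m where "x / \<delta> < 2 ^ m" using real_arch_pow[of 2] by auto
  then have ex: "x < 2 ^ m * \<delta>" using assms by (simp add: field_simps)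
  have n: "x < 2 ^ n * \<delta>" unfolding n_def by (rule LeastI) (rule ex)
  have "n \<noteq> 0" using n assms by (cases "n = 0") auto
  then obtain k where k: "n = Suc k" by (cases n) auto
  then have "2 ^ k * \<delta> \<le> x" using not_less_Least[of k "\<lambda>n. x < 2 ^ n * \<delta>"] by (simp add: n_def)
  moreover have "x < 2 ^ Suc k * \<delta>" using n unfolding k .
  ultimately show thesis by (rule that)
qed

text \<open>
  On the dyadic annulus at distance about \<open>2 ^ k * \<delta>\<close> from \<open>a\<close> the integrand is at most
  \<open>(2 ^ k * \<delta>) ^ -4\<close>, while the area is of order \<open>(2 ^ k * \<delta>)\<^sup>2\<close>; the contributions form a
  geometric series of ratio \<open>1 / 4\<close>.
\<close>
lemma nn_integral_inverse_power4_le: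
  fixes a :: complex
  assumes \<delta>: "0 < \<delta>" and S: "\<And>z. z \<in> S \<Longrightarrow> \<delta> \<le> norm (z - a)"
  shows "(\<integral>\<^sup>+z\<in>S. ennreal (1 / norm (z - a) ^ 4) \<partial>lborel) \<le> ennreal (16 / 3 * pi / \<delta>\<^sup>2)"
proof -
  define c where "c k = 1 / (2 ^ k * \<delta>) ^ 4" for k :: nat
  define B where "B k = ball a (2 ^ Suc k * \<delta>)" for k :: nat
  have "(\<integral>\<^sup>+z\<in>S. ennreal (1 / norm (z - a) ^ 4) \<partial>lborel)
      \<le> (\<integral>\<^sup>+z. (\<Sum>k. ennreal (c k) * indicator (B k) z) \<partial>lborel)"
  proof (rule nn_integral_mono)
    fix z
    show "ennreal (1 / norm (z - a) ^ 4) * indicator S z \<le> (\<Sum>k. ennreal (c k) * indicator (B k) z)"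
    proof (cases "z \<in> S")
      case True
      obtain k where k: "2 ^ k * \<delta> \<le> norm (z - a)" "norm (z - a) < 2 ^ Suc k * \<delta>"
        using dyadic_scale[OF \<delta> S[OF True]] by blast
      have "0 < norm (z - a)" using \<delta> S[OF True] by linarith
      then have "1 / norm (z - a) ^ 4 \<le> c k"
        unfolding c_def using k \<delta>
        by (intro divide_left_mono power_mono mult_pos_pos zero_less_power) auto
      then have "ennreal (1 / norm (z - a) ^ 4) * indicator S z \<le> ennreal (c k) * indicator (B k) z"
        using True k by (simp add: B_def dist_norm norm_minus_commute ennreal_leI)
      also have "\<dots> = (\<Sum>i\<in>{k}. ennreal (c i) * indicator (B i) z)"
        by (subst sum.insert) simp_all
      also have "\<dots> \<le> (\<Sum>i. ennreal (c i) * indicator (B i) z)"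
        by (rule sum_le_suminf) auto
      finally show ?thesis .
    qed simp
  qed
  also have "\<dots> = (\<Sum>k. ennreal (c k) * emeasure lborel (B k))"
    by (subst nn_integral_suminf)
      (auto simp: B_def nn_integral_cmult_indicator
        intro!: borel_measurable_times_ennreal borel_measurable_indicator)
  also have "\<dots> = (\<Sum>k. ennreal (4 * pi / \<delta>\<^sup>2 * (1 / 4) ^ k))"
  proof (rule suminf_cong)
    fix k :: nat
    define x where "x = 2 ^ k * \<delta>"
    have x: "0 < x" using \<delta> by (simp add: x_def)
    have "c k = 1 / x ^ 4" by (simp add: c_def x_def)
    then have "c k * (pi * (2 * x)\<^sup>2) = 4 * pi / x\<^sup>2"
      using x by (simp add: field_simps power2_eq_square power4_eq_xxxx)
    also have "x\<^sup>2 = 4 ^ k * \<delta>\<^sup>2"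
      by (simp add: x_def power2_eq_square mult_ac flip: power_mult_distrib)
    also have "4 * pi / (4 ^ k * \<delta>\<^sup>2) = 4 * pi / \<delta>\<^sup>2 * (1 / 4) ^ k"
      by (simp add: power_one_over)
    finally have "c k * (pi * (2 ^ Suc k * \<delta>)\<^sup>2) = 4 * pi / \<delta>\<^sup>2 * (1 / 4) ^ k"
      by (simp only: x_def power_Suc mult.assoc)
    then show "ennreal (c k) * emeasure lborel (B k) = ennreal (4 * pi / \<delta>\<^sup>2 * (1 / 4) ^ k)"
      using \<delta> by (simp add: B_def emeasure_lborel_complex_ball c_def flip: ennreal_mult'')
  qed
  also have "\<dots> = ennreal (4 * pi / \<delta>\<^sup>2 * (1 / (1 - 1 / 4)))"
    by (intro suminf_ennreal_eq sums_mult geometric_sums) auto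
  finally show ?thesis by (simp add: field_simps)
qed

text \<open>
  The \<open>p\<close>-th power of its modulus, \<open>(1 - \<bar>w\<bar>\<^sup>2)\<^sup>2 / \<bar>1 - cnj w * z\<bar> ^ 4\<close>, is the Jacobian of the disk
  automorphism exchanging \<open>0\<close> and \<open>w\<close>. Hence its mass near \<open>w\<close> is comparable to its total mass,
  which makes it nearly extremal for the growth estimates at \<open>w\<close>.
\<close>
definition bergman_test :: "real \<Rightarrow> complex \<Rightarrow> complex \<Rightarrow> complex" where
  "bergman_test p w z =
     of_real ((1 - (norm w)\<^sup>2) powr (2 / p)) * (1 - cnj w * z) powr of_real (- (4 / p))"

text \<open>
  This keeps the argument of the complex power off the branch cut of the principal logarithm.
\<close>
lemma Re_one_minus_pos:
  assumes "w \<in> unit_disk" "z \<in> unit_disk"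
  shows "0 < Re (1 - cnj w * z)"
proof -
  have "Re (cnj w * z) \<le> norm w * norm z"
    using complex_Re_le_cmod[of "cnj w * z"] by (simp add: norm_mult)
  also have "\<dots> \<le> norm w * 1"
    using assms by (intro mult_left_mono) auto
  also have "\<dots> < 1" using assms by simp
  finally show ?thesis by simp
qed

lemma has_field_derivative_bergman_test:
  assumes "w \<in> unit_disk" "z \<in> unit_disk"
  shows "(bergman_test p w has_field_derivative
    of_real (4 / p * (1 - (norm w)\<^sup>2) powr (2 / p)) * cnj w *
      (1 - cnj w * z) powr of_real (- (4 / p) - 1)) (at z)"
  unfolding bergman_test_def
  using Re_one_minus_pos[OF assms]
  by (auto intro!: derivative_eq_intros simp: complex_nonpos_Reals_iff)

lemma holomorphic_bergman_test:
  "w \<in> unit_disk \<Longrightarrow> bergman_test p w holomorphic_on unit_disk"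
  using has_field_derivative_bergman_test holomorphic_on_open[OF open_ball] by blast

lemma norm_deriv_bergman_test_diagonal:
  assumes p: "0 < p" and w: "w \<in> unit_disk"
  shows "norm (deriv (bergman_test p w) w)
    = 4 / p * norm w / (1 - (norm w)\<^sup>2) powr (1 + 2 / p)"
proof -
  have pos: "0 < 1 - (norm w)\<^sup>2" using w by (simp add: power_less_one_iff)
  have "1 - cnj w * w = of_real (1 - (norm w)\<^sup>2)"
    by (simp add: mult.commute flip: complex_norm_square)
  then have "norm (deriv (bergman_test p w) w)
      = 4 / p * (1 - (norm w)\<^sup>2) powr (2 / p) * norm w * (1 - (norm w)\<^sup>2) powr (- (4 / p) - 1)"
    using pos p DERIV_imp_deriv[OF has_field_derivative_bergman_test[OF w w, of p]]
    by (simp add: norm_mult norm_divide norm_powr_real_powr' del: of_real_diff of_real_power)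
  also have "\<dots> = 4 / p * norm w * ((1 - (norm w)\<^sup>2) powr (2 / p) * (1 - (norm w)\<^sup>2) powr (- (4 / p) - 1))"
    by simp
  also have "(1 - (norm w)\<^sup>2) powr (2 / p) * (1 - (norm w)\<^sup>2) powr (- (4 / p) - 1)
      = (1 - (norm w)\<^sup>2) powr (- (1 + 2 / p))"
    unfolding powr_add[symmetric] using p
    by (intro arg_cong2[where f = "(powr)"] refl) (simp add: field_simps)
  finally show ?thesis by (simp add: powr_minus divide_inverse del: minus_add_distrib)
qed

lemma norm_bergman_test_powr:
  assumes p: "0 < p" and w: "w \<in> unit_disk" and z: "z \<in> unit_disk"
  shows "norm (bergman_test p w z) powr p = (1 - (norm w)\<^sup>2)\<^sup>2 / norm (1 - cnj w * z) ^ 4"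
proof -
  have pos: "0 < 1 - (norm w)\<^sup>2" using w by (simp add: power_less_one_iff)
  have "1 - cnj w * z \<noteq> 0" using Re_one_minus_pos[OF w z] by force
  then have "0 < norm (1 - cnj w * z)" by simp
  moreover have "norm (bergman_test p w z)
      = (1 - (norm w)\<^sup>2) powr (2 / p) * norm (1 - cnj w * z) powr (- (4 / p))"
    by (simp add: bergman_test_def norm_mult norm_powr_real_powr')
  ultimately show ?thesis
    using pos p by (simp add: powr_divide powr_powr powr_minus_divide)
qed

lemma bergman_test_in_bergman_space:
  assumes p: "0 < p" and w: "w \<in> unit_disk"
  shows "bergman_test p w \<in> bergman_space p"
proof (rule bounded_holomorphic_in_bergman_space[OF p holomorphic_bergman_test[OF w]])
  fix z assume z: "z \<in> unit_disk"
  have "norm (cnj w * z) \<le> norm w * 1"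
    unfolding norm_mult using z by (intro mult_mono) auto
  then have "1 - norm w \<le> norm (1 - cnj w * z)"
    using norm_triangle_ineq2[of 1 "cnj w * z"] by simp
  then show "norm (bergman_test p w z)
      \<le> (1 - (norm w)\<^sup>2) powr (2 / p) * (1 - norm w) powr (- (4 / p))"
    unfolding bergman_test_def norm_mult using p w
    by (intro mult_mono) (auto simp: norm_powr_real_powr' powr_mono2')
qed

text \<open>
  Since \<open>1 - cnj w * z = - cnj w * (z - 1 / cnj w)\<close>, the condition \<open>\<bar>w\<bar> \<ge> 1 / 2\<close> makes
  \<open>\<bar>1 - cnj w * z\<bar>\<close> at least half the distance to \<open>1 / cnj w\<close>, which in turn is at least
  \<open>1 - \<bar>w\<bar>\<close>. The factor \<open>(1 - \<bar>w\<bar>\<^sup>2)\<^sup>2\<close> then cancels the size \<open>(1 - \<bar>w\<bar>) ^ -2\<close> of the integral.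
\<close>
lemma bergman_norm_bergman_test_le:
  assumes p: "0 < p" and w: "w \<in> unit_disk" "1 / 2 \<le> norm w"
  shows "bergman_norm p (bergman_test p w) \<le> 1024 powr (1 / p)"
proof -
  define \<delta> where "\<delta> = 1 - norm w"
  have \<delta>: "0 < \<delta>" using w by (simp add: \<delta>_def)
  have w0: "w \<noteq> 0" using w by auto
  have dist: "\<delta> \<le> norm (z - 1 / cnj w)" if "z \<in> unit_disk" for z
  proof -
    have "norm w * (2 - norm w) \<le> 1"
      using zero_le_power2[of "1 - norm w"] by (simp add: power2_eq_square algebra_simps)
    then have "2 - norm w \<le> 1 / norm w" using w0 by (simp add: field_simps)
    moreover have "norm (1 / cnj w) = 1 / norm w" by (simp add: norm_divide)
    ultimately show ?thesis
      using norm_triangle_ineq2[of "1 / cnj w" z] that by (simp add: \<delta>_def norm_minus_commute)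
  qed
  have le: "norm (bergman_test p w z) powr p \<le> 64 * \<delta>\<^sup>2 * (1 / norm (z - 1 / cnj w) ^ 4)"
    if z: "z \<in> unit_disk" for z
  proof -
    have pos: "0 < norm (z - 1 / cnj w)" using dist[OF z] \<delta> by linarith
    have "1 - cnj w * z = - cnj w * (z - 1 / cnj w)" using w0 by (simp add: field_simps)
    then have "norm (1 - cnj w * z) = norm w * norm (z - 1 / cnj w)"
      by (simp only: norm_mult norm_minus_cancel complex_mod_cnj)
    then have half: "norm (z - 1 / cnj w) / 2 \<le> norm (1 - cnj w * z)"
      using w mult_right_mono[of "1/2" "norm w" "norm (z - 1 / cnj w)"] by simp
    have "1 - (norm w)\<^sup>2 = (1 + norm w) * \<delta>"
      by (simp add: \<delta>_def power2_eq_square algebra_simps)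
    also have "\<dots> \<le> 2 * \<delta>" using w \<delta> by (intro mult_right_mono) auto
    finally have "(1 - (norm w)\<^sup>2)\<^sup>2 \<le> (2 * \<delta>)\<^sup>2"
      using w by (intro power_mono) (auto simp: power_le_one)
    then have "norm (bergman_test p w z) powr p \<le> (2 * \<delta>)\<^sup>2 / (norm (z - 1 / cnj w) / 2) ^ 4"
      unfolding norm_bergman_test_powr[OF p w(1) z]
      using half pos by (intro frac_le[OF zero_le_power2]) (auto intro: power_mono)
    also have "\<dots> = 64 * \<delta>\<^sup>2 * (1 / norm (z - 1 / cnj w) ^ 4)"
      by (simp add: power_divide power_mult_distrib)
    finally show ?thesis .
  qed
  have "(\<integral>\<^sup>+z. ennreal (norm (bergman_test p w z) powr p) \<partial>disk_area)
      = ennreal (1 / pi) * (\<integral>\<^sup>+z\<in>unit_disk. ennreal (norm (bergman_test p w z) powr p) \<partial>lborel)"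
    by (intro nn_integral_disk_area measurable_compose[OF _ measurable_ennreal]
        norm_powr_measurable_disk_area holomorphic_on_imp_continuous_on
        holomorphic_bergman_test w)
  also have "\<dots> \<le> ennreal (1 / pi) * (\<integral>\<^sup>+z. ennreal (64 * \<delta>\<^sup>2) *
      (ennreal (1 / norm (z - 1 / cnj w) ^ 4) * indicator unit_disk z) \<partial>lborel)"
    using le by (intro mult_left_mono nn_integral_mono)
      (auto simp: indicator_def simp flip: ennreal_mult intro!: ennreal_leI)
  also have "\<dots> = ennreal (1 / pi) * (ennreal (64 * \<delta>\<^sup>2) *
      (\<integral>\<^sup>+z\<in>unit_disk. ennreal (1 / norm (z - 1 / cnj w) ^ 4) \<partial>lborel))"
    by (subst nn_integral_cmult)
      (auto intro!: borel_measurable_times_ennreal borel_measurable_indicator)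
  also have "\<dots> \<le> ennreal (1 / pi) * (ennreal (64 * \<delta>\<^sup>2) * ennreal (16 / 3 * pi / \<delta>\<^sup>2))"
    using dist by (intro mult_left_mono nn_integral_inverse_power4_le[OF \<delta>]) auto
  also have "\<dots> = ennreal (1024 / 3)"
    using \<delta> by (simp flip: ennreal_mult)
  also have "\<dots> \<le> ennreal 1024" by (rule ennreal_leI) simp
  finally have "(\<integral>z. norm (bergman_test p w z) powr p \<partial>disk_area) \<le> 1024"
    by (intro integral_real_bounded) auto
  then show ?thesis
    unfolding bergman_norm_def using p by (intro powr_mono2) auto
qed

section \<open>Composition operators into the Bloch space\<close>

lemma bloch_seminorm_upper:
  assumes "f \<in> bloch_space" "z \<in> unit_disk"
  shows "(1 - (norm z)\<^sup>2) * norm (deriv f z) \<le> bloch_norm f"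
proof -
  have "(1 - (norm z)\<^sup>2) * norm (deriv f z) \<le> bloch_seminorm f"
    unfolding bloch_seminorm_def using assms by (intro cSUP_upper) (auto simp: bloch_space_def)
  then show ?thesis by (simp add: bloch_norm_def add_increasing)
qed

lemma analytic_self_map_in_disk:
  "analytic_self_map \<phi> \<Longrightarrow> z \<in> unit_disk \<Longrightarrow> \<phi> z \<in> unit_disk"
  unfolding analytic_self_map_def by blast

lemma deriv_composition_operator:
  assumes "analytic_self_map \<phi>" "f holomorphic_on unit_disk" "z \<in> unit_disk"
  shows "deriv (composition_operator \<phi> f) z = deriv f (\<phi> z) * deriv \<phi> z"
  unfolding composition_operator_def
proof (rule deriv_chain)
  show "\<phi> field_differentiable at z"
    using assms by (auto simp: analytic_self_map_def intro: holomorphic_on_imp_differentiable_at)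
  show "f field_differentiable at (\<phi> z)"
    using assms(2) analytic_self_map_in_disk[OF assms(1,3)]
    by (rule holomorphic_on_imp_differentiable_at[OF _ open_ball])
qed

lemma holomorphic_composition_operator:
  assumes "analytic_self_map \<phi>" "f holomorphic_on unit_disk"
  shows "composition_operator \<phi> f holomorphic_on unit_disk"
  using assms unfolding analytic_self_map_def composition_operator_def
  by (blast intro: holomorphic_on_compose_gen)

lemma bounded_operatorI_norm_le:
  assumes "\<And>f. f \<in> X \<Longrightarrow> T f \<in> Y" "0 \<le> C" "\<And>f. f \<in> X \<Longrightarrow> nY (T f) \<le> C * nX f"
  shows "bounded_operator X nX Y nY T"
  unfolding bounded_operator_def norm_bounded_def
proof (intro conjI allI impI)
  show "T ` X \<subseteq> Y" using assms(1) by blast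
  fix S assume S: "S \<subseteq> X" and "\<exists>M. \<forall>f\<in>S. nX f \<le> M"
  then obtain M where M: "\<forall>f\<in>S. nX f \<le> M" by blast
  have "nY (T f) \<le> C * M" if "f \<in> S" for f
  proof -
    have "nY (T f) \<le> C * nX f" using assms(3) S that by blast
    also have "\<dots> \<le> C * M" using M that assms(2) by (intro mult_left_mono) auto
    finally show ?thesis .
  qed
  then show "\<exists>M. \<forall>g\<in>T ` S. nY g \<le> M" by blast
qed

text \<open>
  The growth estimate for derivatives at \<open>\<phi> z\<close> controls the Bloch seminorm of \<open>f \<circ> \<phi>\<close>, and the
  growth estimate for values at the single point \<open>\<phi> 0\<close> controls the remaining term of the Bloch norm.
\<close>
lemma composition_operator_bounded:
  assumes \<phi>: "analytic_self_map \<phi>" and p: "0 < p"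
    and K: "\<And>z. z \<in> unit_disk \<Longrightarrow> (1 - (norm z)\<^sup>2) * norm (deriv \<phi> z)
                         / (1 - (norm (\<phi> z))\<^sup>2) powr (1 + 2 / p) \<le> K"
  shows "bounded_operator (bergman_space p) (bergman_norm p) bloch_space bloch_norm
           (composition_operator \<phi>)"
proof -
  obtain A where A: "0 < A" "\<And>f w. f \<in> bergman_space p \<Longrightarrow> w \<in> unit_disk \<Longrightarrow>
      norm (f w) \<le> A * bergman_norm p f / (1 - norm w) powr (2 / p)"
    using bergman_growth[OF p] by blast
  obtain B where B: "0 < B" "\<And>f w. f \<in> bergman_space p \<Longrightarrow> w \<in> unit_disk \<Longrightarrow>
      norm (deriv f w) \<le> B * bergman_norm p f / (1 - (norm w)\<^sup>2) powr (1 + 2 / p)"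
    using bergman_deriv_growth[OF p] by blast
  note \<phi>_disk = analytic_self_map_in_disk[OF \<phi>]
  have K0: "0 \<le> K"
    using K[of 0] by (simp add: order_trans[rotated])
  have bound: "(1 - (norm z)\<^sup>2) * norm (deriv (composition_operator \<phi> f) z) \<le> B * K * bergman_norm p f"
    if f: "f \<in> bergman_space p" and z: "z \<in> unit_disk" for f z
  proof -
    have hol: "f holomorphic_on unit_disk" using f by (simp add: bergman_space_def)
    have nonneg: "0 \<le> (1 - (norm z)\<^sup>2) * norm (deriv \<phi> z)"
      using z by (simp add: power_le_one)
    have "(1 - (norm z)\<^sup>2) * norm (deriv (composition_operator \<phi> f) z)
        = norm (deriv f (\<phi> z)) * ((1 - (norm z)\<^sup>2) * norm (deriv \<phi> z))"
      by (simp add: deriv_composition_operator[OF \<phi> hol z] norm_mult)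
    also have "\<dots> \<le> B * bergman_norm p f / (1 - (norm (\<phi> z))\<^sup>2) powr (1 + 2 / p)
        * ((1 - (norm z)\<^sup>2) * norm (deriv \<phi> z))"
      by (intro mult_right_mono B(2) f \<phi>_disk z nonneg)
    also have "\<dots> = B * bergman_norm p f * ((1 - (norm z)\<^sup>2) * norm (deriv \<phi> z)
        / (1 - (norm (\<phi> z))\<^sup>2) powr (1 + 2 / p))"
      by simp
    also have "\<dots> \<le> B * bergman_norm p f * K"
      using B(1) bergman_norm_nonneg by (intro mult_left_mono K z mult_nonneg_nonneg) auto
    finally show ?thesis by (simp add: mult_ac)
  qed
  define E where "E = A / (1 - norm (\<phi> 0)) powr (2 / p)"
  show ?thesis
  proof (rule bounded_operatorI_norm_le)
    show "0 \<le> E + B * K" using A(1) B(1) K0 by (simp add: E_def)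
    fix f assume f: "f \<in> bergman_space p"
    have "bdd_above ((\<lambda>z. (1 - (norm z)\<^sup>2) * norm (deriv (composition_operator \<phi> f) z)) ` unit_disk)"
      by (rule bdd_aboveI2, rule bound[OF f])
    then show "composition_operator \<phi> f \<in> bloch_space"
      using f holomorphic_composition_operator[OF \<phi>]
      by (simp add: bloch_space_def bergman_space_def)
    have "bloch_seminorm (composition_operator \<phi> f) \<le> B * K * bergman_norm p f"
      unfolding bloch_seminorm_def using bound[OF f] by (intro cSUP_least) auto
    moreover have "norm (composition_operator \<phi> f 0) \<le> E * bergman_norm p f"
      using A(2)[OF f \<phi>_disk[of 0]] by (simp add: composition_operator_def E_def)
    ultimately show "bloch_norm (composition_operator \<phi> f) \<le> (E + B * K) * bergman_norm p f"
      by (simp add: bloch_norm_def distrib_right)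
  qed
qed

text \<open>
  Evaluating the image of the test function with parameter \<open>w = \<phi> z\<close> at the point \<open>z\<close> itself
  reproduces the quantity to be bounded, times \<open>4 / p * \<bar>\<phi> z\<bar>\<close>. Where \<open>\<bar>\<phi> z\<bar> < 1 / 2\<close> this factor may
  degenerate; there \<open>(1 - \<bar>z\<bar>\<^sup>2) * \<bar>\<phi>' z\<bar>\<close> is bounded because \<open>\<phi>\<close>, the image of the
  identity, is a Bloch function, and the denominator stays away from \<open>0\<close>.
\<close>
lemma composition_operator_bounded_imp:
  assumes \<phi>: "analytic_self_map \<phi>" and p: "0 < p"
    and bounded: "bounded_operator (bergman_space p) (bergman_norm p) bloch_space bloch_norm
           (composition_operator \<phi>)"
  shows "bdd_above ((\<lambda>z. (1 - (norm z)\<^sup>2) * norm (deriv \<phi> z)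
                         / (1 - (norm (\<phi> z))\<^sup>2) powr (1 + 2 / p)) ` unit_disk)"
proof -
  define s where "s = 1 + 2 / p"
  define W where "W = {w \<in> unit_disk. 1 / 2 \<le> norm w}"
  have into: "composition_operator \<phi> f \<in> bloch_space" if "f \<in> bergman_space p" for f
    using bounded that by (auto simp: bounded_operator_def)
  have test: "bergman_test p w \<in> bergman_space p" if "w \<in> unit_disk" for w
    by (rule bergman_test_in_bergman_space[OF p that])
  have "norm_bounded (bergman_norm p) (bergman_test p ` W)"
    using bergman_norm_bergman_test_le[OF p] by (auto simp: norm_bounded_def W_def)
  moreover have "bergman_test p ` W \<subseteq> bergman_space p"
    using test by (auto simp: W_def)
  ultimately have "norm_bounded bloch_norm (composition_operator \<phi> ` bergman_test p ` W)"
    using bounded by (simp add: bounded_operator_def)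
  then obtain M where M: "\<And>w. w \<in> W \<Longrightarrow> bloch_norm (composition_operator \<phi> (bergman_test p w)) \<le> M"
    by (auto simp: norm_bounded_def)
  have id: "(\<lambda>z. z) \<in> bergman_space p"
    using p by (intro bounded_holomorphic_in_bergman_space[where M = 1]) auto
  define N where "N = bloch_norm (composition_operator \<phi> (\<lambda>z. z))"
  have "(1 - (norm z)\<^sup>2) * norm (deriv \<phi> z) / (1 - (norm (\<phi> z))\<^sup>2) powr s
      \<le> max (M * p / 2) (N / (3 / 4) powr s)" if z: "z \<in> unit_disk" for z
  proof (cases "1 / 2 \<le> norm (\<phi> z)")
    case True
    have w: "\<phi> z \<in> unit_disk" by (rule analytic_self_map_in_disk[OF \<phi> z])
    have nonneg: "0 \<le> (1 - (norm z)\<^sup>2) * norm (deriv \<phi> z)"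
      using z by (simp add: power_le_one)
    define X where "X = (1 - (norm z)\<^sup>2) * norm (deriv \<phi> z) / (1 - (norm (\<phi> z))\<^sup>2) powr s"
    have "1 / 2 * X \<le> norm (\<phi> z) * X"
      unfolding X_def using True nonneg by (intro mult_right_mono divide_nonneg_nonneg) auto
    then have "4 / p * (1 / 2 * X) \<le> 4 / p * (norm (\<phi> z) * X)"
      using p by (intro mult_left_mono) auto
    also have "\<dots>
        = (1 - (norm z)\<^sup>2) * norm (deriv (composition_operator \<phi> (bergman_test p (\<phi> z))) z)"
      unfolding deriv_composition_operator[OF \<phi> holomorphic_bergman_test[OF w] z] norm_mult
        norm_deriv_bergman_test_diagonal[OF p w] s_def X_def
      by simp
    also have "\<dots> \<le> M"
      using bloch_seminorm_upper[OF into[OF test[OF w]] z] M[of "\<phi> z"] w True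
      by (simp add: W_def)
    finally have "X \<le> M * p / 2" using p by (simp add: field_simps)
    then show ?thesis by (simp add: X_def le_max_iff_disj)
  next
    case False
    have "(norm (\<phi> z))\<^sup>2 \<le> (1 / 2)\<^sup>2" using False by (intro power_mono) auto
    then have "3 / 4 \<le> 1 - (norm (\<phi> z))\<^sup>2" by (simp add: power2_eq_square)
    then have "(3 / 4) powr s \<le> (1 - (norm (\<phi> z))\<^sup>2) powr s"
      using p by (intro powr_mono2) (auto simp: s_def)
    moreover have "(1 - (norm z)\<^sup>2) * norm (deriv \<phi> z) \<le> N"
      using bloch_seminorm_upper[OF into[OF id] z] by (simp add: N_def composition_operator_def comp_def)
    moreover have "0 \<le> (1 - (norm z)\<^sup>2) * norm (deriv \<phi> z)"
      using z by (simp add: power_le_one)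
    ultimately have "(1 - (norm z)\<^sup>2) * norm (deriv \<phi> z) / (1 - (norm (\<phi> z))\<^sup>2) powr s
        \<le> N / (3 / 4) powr s"
      by (intro frac_le) auto
    then show ?thesis by simp
  qed
  then show ?thesis unfolding s_def by (rule bdd_aboveI2)
qed

theorem corollary3p7:
  fixes \<phi> :: "complex \<Rightarrow> complex" and p :: real
  assumes "analytic_self_map \<phi>" and "0 < p"
  shows "bounded_operator (bergman_space p) (bergman_norm p) bloch_space bloch_norm
           (composition_operator \<phi>) \<longleftrightarrow>
         bdd_above ((\<lambda>z. (1 - (norm z)\<^sup>2) * norm (deriv \<phi> z)
                         / (1 - (norm (\<phi> z))\<^sup>2) powr (1 + 2 / p)) ` unit_disk)"
proof
  assume "bounded_operator (bergman_space p) (bergman_norm p) bloch_space bloch_norm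
           (composition_operator \<phi>)"
  then show "bdd_above ((\<lambda>z. (1 - (norm z)\<^sup>2) * norm (deriv \<phi> z)
                         / (1 - (norm (\<phi> z))\<^sup>2) powr (1 + 2 / p)) ` unit_disk)"
    by (rule composition_operator_bounded_imp[OF assms])
next
  assume "bdd_above ((\<lambda>z. (1 - (norm z)\<^sup>2) * norm (deriv \<phi> z)
                         / (1 - (norm (\<phi> z))\<^sup>2) powr (1 + 2 / p)) ` unit_disk)"
  then obtain K where "\<And>z. z \<in> unit_disk \<Longrightarrow> (1 - (norm z)\<^sup>2) * norm (deriv \<phi> z)
                         / (1 - (norm (\<phi> z))\<^sup>2) powr (1 + 2 / p) \<le> K"
    unfolding bdd_above_def by blast
  then show "bounded_operator (bergman_space p) (bergman_norm p) bloch_space bloch_norm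
           (composition_operator \<phi>)"
    by (rule composition_operator_bounded[OF assms])
qed

end
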